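(* Let $d\ge 0$ be an integer, let $V$ be a finite set, let $M\subset\Delta_V$ be a matroidal complex of rank $d+1$, with rank function $\rho$, and let $T\subset M$ be a $\mathbb Z_2$-spanning $d$-tree (of the complex $X=M$). Let $A:|\Delta_V|\to\mathbb R^d$ be an affine map such that $0\in A(S)$ for every cocircuit $S$ of $M$. Then there exists a face $\sigma\in T$ such that $0\in A(\sigma)$.
   Context: An abstract simplicial complex is a family of finite subsets (faces) of a ground set that is closed under taking subsets and contains $\varnothing$; the dimension of a face is its cardinality minus $1$; a facet is an inclusion-maximal face. For a finite set $V$, $\Delta_V:=2^V$ is the full simplex on $V$. For a complex $K$ on $V$ and $W\subseteq V$, $K[W]$ is the induced subcomplex of all faces of $K$ contained in $W$. A complex is pure if all its facets have the same dimension. A subcomplex $M\subset\Delta_V$ is matroidal if $M[W]$ is pure for every $W\subseteq V$. Its rank function is $\rho(W)=\dim M[W]+1$, with $\dim\{\varnothing\}=-1$; the rank of $M$ is $\rho(V)$. When $M$ has rank $d+1$, a cocircuit of $M$ is an inclusion-minimal subset $S\subseteq V$ satisfying $\rho(V\setminus S)\le d$. For a complex $K$ on a finite vertex set $V$, each vertex $v$ is placed at the standard basis vector $e_v\in\mathbb R^V$; for $\sigma\in K$, $|\sigma|=\operatorname{conv}\{e_v:v\in\sigma\}$, $|\sigma|^\circ$ is its relative interior (the open simplex), and $|K|=\bigsqcup_{\sigma\in K}|\sigma|^\circ$. A map $A:|K|\to\mathbb R^d$ is affine if it is the affine extension over each face of its values on the vertices. For $\sigma\in K$ one writes $A(\sigma):=A(|\sigma|^\circ)$.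 In the hypothesis, a cocircuit $S$ is regarded as a face of $\Delta_V$, so $A(S)=A(|S|^\circ)$. Let $X$ be a finite $k$-dimensional simplicial complex. A subcomplex $T\subseteq X$ is a $\mathbb Z_2$-spanning $k$-tree if $T$ contains all faces of $X$ of dimension at most $k-1$ and: (1) $\widetilde H_k(T;\mathbb Z_2)=0$; (2) $\widetilde H_k(T\cup\{\sigma\};\mathbb Z_2)\neq 0$ for every facet $\sigma$ of $X$ that does not belong to $T$. Here $\widetilde H_*$ denotes reduced simplicial homology. *)

theory Defs
  imports "HOL-Analysis.Analysis" "HOL-Algebra.Elementary_Groups" "HOL-Library.Z2"
begin

section \<open>Abstract simplicial complexes\<close>

definition simplicial_complex_on :: "'a set \<Rightarrow> 'a set set \<Rightarrow> bool" where
  "simplicial_complex_on V K \<longleftrightarrow>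
     {} \<in> K \<and> (\<forall>\<sigma>\<in>K. finite \<sigma> \<and> \<sigma> \<subseteq> V) \<and> (\<forall>\<sigma>\<in>K. \<forall>\<tau>. \<tau> \<subseteq> \<sigma> \<longrightarrow> \<tau> \<in> K)"

definition face_dim :: "'a set \<Rightarrow> int" where
  "face_dim \<sigma> = int (card \<sigma>) - 1"

definition complex_dim :: "'a set set \<Rightarrow> int" where
  "complex_dim K = Max (face_dim ` K)"

definition facets :: "'a set set \<Rightarrow> 'a set set" where
  "facets K = {\<sigma> \<in> K. \<forall>\<tau>\<in>K. \<sigma> \<subseteq> \<tau> \<longrightarrow> \<tau> = \<sigma>}"

definition pure_complex :: "'a set set \<Rightarrow> bool" where
  "pure_complex K \<longleftrightarrow> (\<forall>\<sigma>\<in>facets K. \<forall>\<tau>\<in>facets K. face_dim \<sigma> = face_dim \<tau>)"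

definition induced_complex :: "'a set set \<Rightarrow> 'a set \<Rightarrow> 'a set set" where
  "induced_complex K W = {\<sigma> \<in> K. \<sigma> \<subseteq> W}"


section \<open>Matroidal complexes\<close>

text \<open>Elements of \<open>V\<close> that are not vertices of \<open>M\<close> (loops) are allowed.\<close>

definition matroidal :: "'a set \<Rightarrow> 'a set set \<Rightarrow> bool" where
  "matroidal V M \<longleftrightarrow>
     simplicial_complex_on V M \<and> (\<forall>W\<subseteq>V. pure_complex (induced_complex M W))"

definition rank_fun :: "'a set set \<Rightarrow> 'a set \<Rightarrow> int" where
  "rank_fun M W = complex_dim (induced_complex M W) + 1"

text \<open>If \<open>M\<close> has rank \<open>d + 1\<close>, the bound \<open>rank_fun M V - 1\<close> below is \<open>d\<close>.\<close>

definition cocircuit :: "'a set \<Rightarrow> 'a set set \<Rightarrow> 'a set \<Rightarrow> bool" where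
  "cocircuit V M S \<longleftrightarrow>
     S \<subseteq> V \<and> rank_fun M (V - S) \<le> rank_fun M V - 1 \<and>
     (\<forall>S'. S' \<subset> S \<longrightarrow> \<not> rank_fun M (V - S') \<le> rank_fun M V - 1)"


section \<open>Reduced simplicial homology with coefficients in \<open>\<int>/2\<close>\<close>

definition faces_of_dim :: "'a set set \<Rightarrow> int \<Rightarrow> 'a set set" where
  "faces_of_dim K k = {\<sigma> \<in> K. face_dim \<sigma> = k}"

text \<open>
  The chain complex is the augmented one: the empty face spans the chains of dimension \<open>-1\<close>.
\<close>

definition chains :: "int \<Rightarrow> 'a set set \<Rightarrow> ('a set \<Rightarrow> bit) set" where
  "chains k K = {c. \<forall>\<sigma>. \<sigma> \<notin> faces_of_dim K k \<longrightarrow> c \<sigma> = 0}"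

definition boundary_map :: "int \<Rightarrow> 'a set set \<Rightarrow> ('a set \<Rightarrow> bit) \<Rightarrow> ('a set \<Rightarrow> bit)" where
  "boundary_map k K c =
     (\<lambda>\<tau>. if \<tau> \<in> faces_of_dim K (k - 1)
          then \<Sum>\<sigma> | \<sigma> \<in> faces_of_dim K k \<and> \<tau> \<subseteq> \<sigma>. c \<sigma> else 0)"

definition cycles :: "int \<Rightarrow> 'a set set \<Rightarrow> ('a set \<Rightarrow> bit) set" where
  "cycles k K = {c \<in> chains k K. boundary_map k K c = (\<lambda>\<tau>. 0)}"

definition boundaries :: "int \<Rightarrow> 'a set set \<Rightarrow> ('a set \<Rightarrow> bit) set" where
  "boundaries k K = boundary_map (k + 1) K ` chains (k + 1) K"

definition cycle_group :: "int \<Rightarrow> 'a set set \<Rightarrow> ('a set \<Rightarrow> bit) monoid" where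
  "cycle_group k K = \<lparr>carrier = cycles k K, mult = (\<lambda>a b \<sigma>. a \<sigma> + b \<sigma>), one = (\<lambda>\<sigma>. 0)\<rparr>"

definition reduced_homology :: "int \<Rightarrow> 'a set set \<Rightarrow> ('a set \<Rightarrow> bit) set monoid" where
  "reduced_homology k K = cycle_group k K Mod boundaries k K"

text \<open>These simp rules turn sums in \<open>bit\<close> into truth-value tests and hinder linear reasoning.\<close>

declare add_bit_eq_xor [simp del] mult_bit_eq_and [simp del]

lemma boundary_map_add:
  "boundary_map k K (\<lambda>\<sigma>. a \<sigma> + b \<sigma>) = (\<lambda>\<tau>. boundary_map k K a \<tau> + boundary_map k K b \<tau>)"
  by (auto simp: boundary_map_def fun_eq_iff sum.distrib)

lemma group_cycle_group: "group (cycle_group k K)"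
proof (rule groupI)
  show "x \<otimes>\<^bsub>cycle_group k K\<^esub> y \<in> carrier (cycle_group k K)"
    if "x \<in> carrier (cycle_group k K)" "y \<in> carrier (cycle_group k K)" for x y
    using that
    by (simp add: cycle_group_def cycles_def chains_def boundary_map_add)
  show "\<exists>y\<in>carrier (cycle_group k K). y \<otimes>\<^bsub>cycle_group k K\<^esub> x = \<one>\<^bsub>cycle_group k K\<^esub>"
    if "x \<in> carrier (cycle_group k K)" for x
    using that by (intro bexI[of _ x]) (auto simp: cycle_group_def)
qed (auto simp: cycle_group_def cycles_def chains_def boundary_map_def fun_eq_iff add.assoc)

lemma boundary_boundary:
  assumes K: "simplicial_complex_on V K" and fin: "finite K"
  shows "boundary_map (k - 1) K (boundary_map k K c) = (\<lambda>\<tau>. 0)"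
proof
  fix \<rho>
  have finF: "finite (faces_of_dim K j)" for j
    using fin by (simp add: faces_of_dim_def)
  show "boundary_map (k - 1) K (boundary_map k K c) \<rho> = 0"
  proof (cases "\<rho> \<in> faces_of_dim K (k - 1 - 1)")
    case True
    define N where "N \<sigma> = {\<tau> \<in> faces_of_dim K (k - 1). \<rho> \<subseteq> \<tau> \<and> \<tau> \<subseteq> \<sigma>}" for \<sigma>
    have N: "(\<Sum>\<tau>\<in>N \<sigma>. c \<sigma>) = 0" if s: "\<sigma> \<in> faces_of_dim K k" for \<sigma>
    proof (cases "\<rho> \<subseteq> \<sigma>")
      case False
      then have "N \<sigma> = {}" by (auto simp: N_def)
      then show ?thesis by simp
    next
      case sub: True
      have fs: "finite \<sigma>" "\<sigma> \<in> K" and cs: "card \<sigma> = card \<rho> + 2"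
        using s True K by (auto simp: faces_of_dim_def face_dim_def simplicial_complex_on_def)
      have fr: "finite \<rho>" using sub fs finite_subset by blast
      have "card (\<sigma> - \<rho>) = 2" using cs sub fr by (simp add: card_Diff_subset)
      then obtain x y where xy: "\<sigma> - \<rho> = {x, y}" "x \<noteq> y" by (meson card_2_iff)
      have "N \<sigma> = {insert x \<rho>, insert y \<rho>}"
      proof (intro equalityI subsetI)
        fix \<tau> assume t: "\<tau> \<in> N \<sigma>"
        then have ct: "card \<tau> = card \<rho> + 1" and st: "\<rho> \<subseteq> \<tau>" "\<tau> \<subseteq> \<sigma>"
          using True by (auto simp: N_def faces_of_dim_def face_dim_def)
        then have "card (\<tau> - \<rho>) = 1" using fr by (simp add: card_Diff_subset)
        then obtain z where z: "\<tau> - \<rho> = {z}" by (meson card_1_singletonE)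
        then have "\<tau> = insert z \<rho>" "z \<in> {x, y}" using st xy by auto
        then show "\<tau> \<in> {insert x \<rho>, insert y \<rho>}" by auto
      next
        fix \<tau> assume "\<tau> \<in> {insert x \<rho>, insert y \<rho>}"
        then obtain z where z: "\<tau> = insert z \<rho>" "z \<in> {x, y}" by auto
        then have "z \<notin> \<rho>" "z \<in> \<sigma>" using xy by auto
        moreover have "\<tau> \<in> K"
          using z sub \<open>z \<in> \<sigma>\<close> fs K by (auto simp: simplicial_complex_on_def)
        ultimately show "\<tau> \<in> N \<sigma>" using z sub fr True
          by (auto simp: N_def faces_of_dim_def face_dim_def)
      qed
      moreover have "insert x \<rho> \<noteq> insert y \<rho>" using xy by auto
      ultimately show ?thesis by simp
    qed
    have "boundary_map (k - 1) K (boundary_map k K c) \<rho> =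
        (\<Sum>\<tau> | \<tau> \<in> faces_of_dim K (k - 1) \<and> \<rho> \<subseteq> \<tau>.
           \<Sum>\<sigma> | \<sigma> \<in> faces_of_dim K k \<and> \<tau> \<subseteq> \<sigma>. c \<sigma>)"
      using True by (simp add: boundary_map_def)
    also have "\<dots> = (\<Sum>\<sigma>\<in>faces_of_dim K k. \<Sum>\<tau>\<in>N \<sigma>. c \<sigma>)"
      using finF
      by (subst sum.swap_restrict) (auto simp: N_def conj_assoc intro!: sum.cong)
    also have "\<dots> = 0" by (intro sum.neutral ballI N)
    finally show ?thesis .
  qed (simp add: boundary_map_def)
qed

lemma normal_boundaries:
  assumes K: "simplicial_complex_on V K" and fin: "finite K"
  shows "boundaries k K \<lhd> cycle_group k K"
proof -
  interpret group "cycle_group k K" by (rule group_cycle_group)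
  interpret comm_group "cycle_group k K"
    by unfold_locales (auto simp: cycle_group_def add.commute)
  have sub: "boundaries k K \<subseteq> cycles k K"
    using boundary_boundary[OF assms, of "k + 1"]
    by (auto simp: boundaries_def cycles_def chains_def) (auto simp: boundary_map_def)
  have "subgroup (boundaries k K) (cycle_group k K)"
  proof (rule subgroupI)
    show "boundaries k K \<subseteq> carrier (cycle_group k K)" using sub by (simp add: cycle_group_def)
    show "boundaries k K \<noteq> {}" by (auto simp: boundaries_def chains_def)
    show "inv\<^bsub>cycle_group k K\<^esub> a \<in> boundaries k K" if a: "a \<in> boundaries k K" for a
    proof -
      have "inv\<^bsub>cycle_group k K\<^esub> a = a"
        using a sub by (intro inv_equality) (auto simp: cycle_group_def)
      then show ?thesis using a by simp
    qed
    show "a \<otimes>\<^bsub>cycle_group k K\<^esub> b \<in> boundaries k K"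
      if ab: "a \<in> boundaries k K" "b \<in> boundaries k K" for a b
    proof -
      obtain c e where "a = boundary_map (k + 1) K c" "c \<in> chains (k + 1) K"
        and "b = boundary_map (k + 1) K e" "e \<in> chains (k + 1) K"
        using ab by (auto simp: boundaries_def)
      then show ?thesis unfolding boundaries_def
        by (intro image_eqI[where x = "\<lambda>\<sigma>. c \<sigma> + e \<sigma>"])
          (auto simp: cycle_group_def boundary_map_def chains_def fun_eq_iff sum.distrib)
    qed
  qed
  then show ?thesis by (rule subgroup_imp_normal)
qed

lemma trivial_reduced_homology_iff:
  assumes K: "simplicial_complex_on V K" and fin: "finite K"
  shows "trivial_group (reduced_homology k K) \<longleftrightarrow> cycles k K = boundaries k K"
proof -
  interpret normal "boundaries k K" "cycle_group k K" by (rule normal_boundaries[OF assms])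
  have "trivial_group (reduced_homology k K) \<longleftrightarrow>
      rcosets\<^bsub>cycle_group k K\<^esub> (boundaries k K) = {boundaries k K}"
    unfolding trivial_group_def reduced_homology_def
    using factorgroup_is_group by (simp add: FactGroup_def)
  also have "\<dots> \<longleftrightarrow> carrier (cycle_group k K) = boundaries k K"
  proof
    assume L: "rcosets\<^bsub>cycle_group k K\<^esub> (boundaries k K) = {boundaries k K}"
    have "x \<in> boundaries k K" if "x \<in> carrier (cycle_group k K)" for x
      using rcosetsI[OF subset that] rcos_self[OF that subgroup_axioms] L by auto
    then show "carrier (cycle_group k K) = boundaries k K" using subset by blast
  next
    assume "carrier (cycle_group k K) = boundaries k K"
    then show "rcosets\<^bsub>cycle_group k K\<^esub> (boundaries k K) = {boundaries k K}"
      using coset_join2[OF _ subgroup_axioms] one_closed by (auto simp: RCOSETS_def)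
  qed
  finally show ?thesis by (simp add: cycle_group_def)
qed


section \<open>Spanning trees over \<open>\<int>/2\<close>\<close>

text \<open>Intended for finite complexes \<open>X\<close> of dimension \<open>k\<close>.\<close>

definition Z2_spanning_tree :: "nat \<Rightarrow> 'a set set \<Rightarrow> 'a set set \<Rightarrow> bool" where
  "Z2_spanning_tree k X T \<longleftrightarrow>
     T \<subseteq> X \<and> simplicial_complex_on (\<Union>X) T \<and>
     (\<forall>\<sigma>\<in>X. face_dim \<sigma> \<le> int k - 1 \<longrightarrow> \<sigma> \<in> T) \<and>
     trivial_group (reduced_homology (int k) T) \<and>
     (\<forall>\<sigma>\<in>facets X. \<sigma> \<notin> T \<longrightarrow> \<not> trivial_group (reduced_homology (int k) (T \<union> {\<sigma>})))"


section \<open>Geometric realization and affine maps\<close>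

text \<open>
  The ground set is a subset of a finite type \<open>'v\<close>, and the space of real functions on it is a
  coordinate subspace of \<open>real ^ 'v\<close>.
\<close>

definition open_simplex :: "'v::finite set \<Rightarrow> (real ^ 'v) set" where
  "open_simplex \<sigma> = rel_interior (convex hull ((\<lambda>v. axis v 1) ` \<sigma>))"

definition realization :: "'v::finite set set \<Rightarrow> (real ^ 'v) set" where
  "realization K = (\<Union>\<sigma>\<in>K. open_simplex \<sigma>)"

text \<open>
  The target is \<open>topspace (Euclidean_space d)\<close>, i.e. the sequences vanishing from index \<open>d\<close> on;
  unlike the types of class \<open>euclidean_space\<close> this includes dimension \<open>0\<close>.
\<close>

definition affine_map :: "'v::finite set set \<Rightarrow> nat \<Rightarrow> (real ^ 'v \<Rightarrow> nat \<Rightarrow> real) \<Rightarrow> bool" where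
  "affine_map K d A \<longleftrightarrow>
     A ` realization K \<subseteq> topspace (Euclidean_space d) \<and>
     (\<forall>\<sigma>\<in>K. \<forall>u. (\<forall>v\<in>\<sigma>. 0 \<le> u v) \<and> sum u \<sigma> = 1 \<longrightarrow>
        A (\<Sum>v\<in>\<sigma>. u v *\<^sub>R axis v 1) = (\<lambda>i. \<Sum>v\<in>\<sigma>. u v * A (axis v 1) i))"

end

theory Submission
  imports Defs
begin

text \<open>
  Only the vectors \<open>a v = A (e\<^sub>v)\<close> matter. First, some nonempty face \<open>s\<close> of \<open>M\<close> satisfies
  \<open>0 \<in> A s\<close>: this is Barany's argument for the colourful Caratheodory theorem. Among all faces
  take one whose image hull is nearest to the origin. If the nearest point \<open>p\<close> were nonzero, it
  would lie in the hull of a face \<open>\<tau>\<close> with at most \<open>d\<close> vertices; the elements extending \<open>\<tau>\<close>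
  contain a cocircuit, which has 0 as a positive combination, so one of its elements lies on the
  other side of the hyperplane through \<open>p\<close>, and adding it to \<open>\<tau>\<close> gets closer to the origin.

  Now suppose that 0 is in the image of no face of \<open>T\<close>. Then \<open>s\<close> is a facet outside \<open>T\<close>, and
  \<open>T \<union> {s}\<close> carries a \<open>d\<close>-cycle \<open>z\<close> through \<open>s\<close>. For a generic direction \<open>w\<close>, a \<open>d\<close>-face
  whose proper faces avoid 0 covers 0 iff an odd number of its facets span an open cone
  containing \<open>w\<close>. Summed over \<open>z\<close>, the cone count vanishes mod 2 because \<open>z\<close> is a cycle, whereas
  \<open>s\<close> is the only face of \<open>z\<close> that covers 0.
\<close>

text \<open>
  Coefficients are not normalised: for \<open>x = 0\<close> and \<open>\<sigma>\<close> nonempty this says that 0 is in the open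
  simplex on \<open>a ` \<sigma>\<close>, otherwise that \<open>x\<close> is in the open cone on \<open>a ` \<sigma>\<close>. The empty set
  represents only 0, which is what the parity argument needs in dimension 0.
\<close>

definition pos_comb :: "('v \<Rightarrow> 'e::real_vector) \<Rightarrow> 'v set \<Rightarrow> 'e \<Rightarrow> bool" where
  "pos_comb a \<sigma> x \<longleftrightarrow> (\<exists>u. (\<forall>v\<in>\<sigma>. 0 < u v) \<and> (\<Sum>v\<in>\<sigma>. u v *\<^sub>R a v) = x)"

section \<open>Linear dependencies and the pivoting parity\<close>

text \<open>The ratio test of the simplex method: moving from \<open>l\<close> in direction
  \<open>n\<close>, the first coordinate to vanish is one that minimises
  \<open>l v / (- n v)\<close> over the decreasing coordinates.\<close>

lemma ratio_test:
  fixes l n :: "'v \<Rightarrow> real"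
  assumes "finite \<sigma>" "u \<in> \<sigma>" "n u < 0" "\<And>v. v \<in> \<sigma> \<Longrightarrow> 0 \<le> l v"
  obtains t w where "0 \<le> t" "w \<in> \<sigma>" "n w < 0" "l w + t * n w = 0"
    "\<And>v. v \<in> \<sigma> \<Longrightarrow> 0 \<le> l v + t * n v"
proof -
  define N where "N = {v \<in> \<sigma>. n v < 0}"
  define r where "r v = l v / (- n v)" for v
  have N: "finite N" "N \<noteq> {}" using assms by (auto simp: N_def)
  obtain w where w: "w \<in> N" "\<And>v. v \<in> N \<Longrightarrow> r w \<le> r v"
    using N arg_min_if_finite(1)[of N r] arg_min_least[of N _ r] by blast
  show ?thesis
  proof (rule that)
    show t: "0 \<le> r w" using w(1) assms(4)[of w] by (auto simp: r_def N_def divide_le_0_iff)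
    show "w \<in> \<sigma>" "n w < 0" using w(1) by (auto simp: N_def)
    then show "l w + r w * n w = 0" by (simp add: r_def)
    fix v assume v: "v \<in> \<sigma>"
    show "0 \<le> l v + r w * n v"
    proof (cases "n v < 0")
      case True
      then have "r w \<le> r v" using w(2) v by (simp add: N_def)
      then show ?thesis using True by (simp add: r_def field_simps)
    next
      case False
      then show ?thesis using t assms(4)[OF v] by simp
    qed
  qed
qed

text \<open>Coefficients are indexed by \<sigma> and not by its image, so a repeated value of
  \<open>a\<close> is itself a dependency, with coefficients 1 and -1.\<close>

lemma dependent_family:
  fixes a :: "'v \<Rightarrow> 'e::euclidean_space"
  assumes fin: "finite \<sigma>" and lt: "dim (a ` \<sigma>) < card \<sigma>"
  obtains \<mu> v where "v \<in> \<sigma>" "\<mu> v \<noteq> 0" "(\<Sum>v\<in>\<sigma>. \<mu> v *\<^sub>R a v) = 0"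
proof (cases "inj_on a \<sigma>")
  case True
  have "dependent (a ` \<sigma>)"
    using lt card_image[OF True] by (metis dim_eq_card_independent less_irrefl)
  then obtain c x where c: "x \<in> a ` \<sigma>" "c x \<noteq> 0" "(\<Sum>x\<in>a ` \<sigma>. c x *\<^sub>R x) = 0"
    using fin by (auto simp: dependent_finite)
  then show ?thesis using that[of _ "c \<circ> a"] True by (auto simp: sum.reindex)
next
  case False
  then obtain x y where xy: "x \<in> \<sigma>" "y \<in> \<sigma>" "x \<noteq> y" "a x = a y" by (auto simp: inj_on_def)
  define m :: "'v \<Rightarrow> real" where "m v = (if v = x then 1 else 0) - (if v = y then 1 else 0)" for v
  have "(\<Sum>v\<in>\<sigma>. m v *\<^sub>R a v) =
      (\<Sum>v\<in>\<sigma>. if v = x then a v else 0) - (\<Sum>v\<in>\<sigma>. if v = y then a v else 0)"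
    by (auto simp: m_def sum_subtractf[symmetric] intro!: sum.cong)
  also have "\<dots> = 0" using xy fin by simp
  finally show ?thesis using that[of x m] xy by (simp add: m_def)
qed

lemma sum_scale_add:
  fixes a :: "'v \<Rightarrow> 'e::real_vector"
  shows "(\<Sum>v\<in>\<sigma>. (l v + t * n v) *\<^sub>R a v) = (\<Sum>v\<in>\<sigma>. l v *\<^sub>R a v) + t *\<^sub>R (\<Sum>v\<in>\<sigma>. n v *\<^sub>R a v)"
  by (simp add: scaleR_add_left sum.distrib scaleR_sum_right)

lemma sum_fun_upd_zero:
  fixes a :: "'v \<Rightarrow> 'e::real_vector"
  assumes "finite \<sigma>"
  shows "(\<Sum>u\<in>\<sigma>. (l(v := 0)) u *\<^sub>R a u) = (\<Sum>u\<in>\<sigma> - {v}. l u *\<^sub>R a u)"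
  using assms by (intro sum.mono_neutral_cong_right) auto

lemma nonneg_combination_support:
  fixes a :: "'v \<Rightarrow> 'e::real_vector"
  assumes "finite \<sigma>" "\<And>v. v \<in> \<sigma> \<Longrightarrow> 0 \<le> u v"
  shows "pos_comb a {v \<in> \<sigma>. u v \<noteq> 0} (\<Sum>v\<in>\<sigma>. u v *\<^sub>R a v)"
proof -
  have "(\<Sum>v\<in>{v \<in> \<sigma>. u v \<noteq> 0}. u v *\<^sub>R a v) = (\<Sum>v\<in>\<sigma>. u v *\<^sub>R a v)"
    using assms(1) by (intro sum.mono_neutral_left) auto
  then show ?thesis using assms(2) unfolding pos_comb_def by (intro exI[of _ u]) force
qed

text \<open>A vanishing coefficient would make the support a proper subset, nonempty because of
  \<open>w\<close>, that carries a positive dependency.\<close>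

lemma nonneg_dependency_pos:
  fixes a :: "'v \<Rightarrow> 'e::real_vector"
  assumes "finite \<sigma>" "\<And>v. v \<in> \<sigma> \<Longrightarrow> 0 \<le> u v" "(\<Sum>v\<in>\<sigma>. u v *\<^sub>R a v) = 0"
    and "w \<in> \<sigma>" "u w \<noteq> 0"
    and H: "\<And>\<tau>. \<tau> \<subset> \<sigma> \<Longrightarrow> \<tau> \<noteq> {} \<Longrightarrow> \<not> pos_comb a \<tau> 0"
    and "v \<in> \<sigma>"
  shows "0 < u v"
proof (rule ccontr)
  assume "\<not> 0 < u v"
  then have "u v = 0" using assms(2)[OF assms(7)] by simp
  then have "\<not> pos_comb a {v \<in> \<sigma>. u v \<noteq> 0} 0" using assms(4,5,7) by (intro H) auto
  then show False
    using nonneg_combination_support[of \<sigma> u a] assms(1,2,3) by simp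
qed

text \<open>The vectors other than one chosen \<open>v0\<close> are independent, and there are
  \<open>dim W\<close> of them. Indeed, a nonzero dependency vanishing at \<open>v0\<close>, or its
  negative, has a negative entry; adding multiples of it to the positive dependency kills a
  coefficient while the one at \<open>v0\<close> stays positive, against minimality.\<close>

lemma minimal_dependency_spans:
  fixes a :: "'v \<Rightarrow> 'e::euclidean_space"
  assumes fin: "finite \<sigma>" and c: "card \<sigma> = Suc (dim W)" and W: "subspace W" "a ` \<sigma> \<subseteq> W"
    and H: "\<And>\<tau>. \<tau> \<subset> \<sigma> \<Longrightarrow> \<tau> \<noteq> {} \<Longrightarrow> \<not> pos_comb a \<tau> 0"
    and p: "pos_comb a \<sigma> 0"
  shows "W \<subseteq> span (a ` \<sigma>)"
proof -
  obtain m where m: "\<And>v. v \<in> \<sigma> \<Longrightarrow> 0 < m v" "(\<Sum>v\<in>\<sigma>. m v *\<^sub>R a v) = 0"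
    using p by (auto simp: pos_comb_def)
  obtain v0 where v0: "v0 \<in> \<sigma>" using c by fastforce
  have no_neg: "\<not> n u < 0"
    if n: "(\<Sum>v\<in>\<sigma>. n v *\<^sub>R a v) = 0" "n v0 = 0" "u \<in> \<sigma>" for n u
  proof
    assume "n u < 0"
    then obtain t w where t: "0 \<le> t" "w \<in> \<sigma>" "m w + t * n w = 0"
      "\<And>v. v \<in> \<sigma> \<Longrightarrow> 0 \<le> m v + t * n v"
      using ratio_test[OF fin n(3), of n m] m(1) by (metis less_imp_le)
    have "0 < m w + t * n w"
      by (rule nonneg_dependency_pos[where u = "\<lambda>v. m v + t * n v", OF fin t(4) _ v0 _ H t(2)])
        (use m n v0 in \<open>auto simp: sum_scale_add less_le\<close>)
    then show False using t by simp
  qed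
  have "card (\<sigma> - {v0}) \<le> dim (a ` (\<sigma> - {v0}))"
  proof (rule ccontr)
    assume "\<not> ?thesis"
    then obtain n v where n: "v \<in> \<sigma> - {v0}" "n v \<noteq> 0" "(\<Sum>v\<in>\<sigma> - {v0}. n v *\<^sub>R a v) = 0"
      using dependent_family[of "\<sigma> - {v0}" a] fin by (metis finite_Diff not_le)
    define n' where "n' = n(v0 := 0)"
    have s: "(\<Sum>v\<in>\<sigma>. n' v *\<^sub>R a v) = 0"
      using n(3) unfolding n'_def sum_fun_upd_zero[OF fin] .
    have "\<not> n' v < 0" using s n(1) by (intro no_neg) (auto simp: n'_def)
    moreover have "\<not> - n' v < 0" using s n(1) by (intro no_neg) (auto simp: n'_def sum_negf)
    ultimately show False using n by (auto simp: n'_def)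
  qed
  also have "\<dots> \<le> dim (a ` \<sigma>)" by (intro dim_subset) auto
  finally have "dim W \<le> dim (span (a ` \<sigma>))" using c fin v0 by simp
  then have "span (a ` \<sigma>) = W"
    using W by (intro subspace_dim_equal) (auto simp: span_minimal)
  then show ?thesis by simp
qed

lemma span_imageE:
  fixes a :: "'v \<Rightarrow> 'e::real_vector"
  assumes fin: "finite \<sigma>" and "x \<in> span (a ` \<sigma>)"
  obtains l where "(\<Sum>v\<in>\<sigma>. l v *\<^sub>R a v) = x"
proof -
  obtain U where U: "U \<subseteq> \<sigma>" "inj_on a U" "a ` \<sigma> = a ` U"
    using subset_image_inj[of "a ` \<sigma>" a \<sigma>] by blast
  have "x \<in> range (\<lambda>c. \<Sum>y\<in>a ` U. c y *\<^sub>R y)"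
    using assms(2) fin by (simp only: span_finite finite_imageI U(3)[symmetric])
  then obtain c where "x = (\<Sum>y\<in>a ` U. c y *\<^sub>R y)" by (rule rangeE)
  also have "\<dots> = (\<Sum>v\<in>U. c (a v) *\<^sub>R a v)" using U(2) by (simp add: sum.reindex)
  also have "\<dots> = (\<Sum>v\<in>\<sigma>. (if v \<in> U then c (a v) else 0) *\<^sub>R a v)"
    using U(1) fin by (intro sum.mono_neutral_cong_left) auto
  finally show ?thesis using that by metis
qed

text \<open>
  A pivoting step. The solutions \<open>l\<close> of \<open>\<Sum> l v *\<^sub>R a v = w\<close> form a line, and the facets counted are
  the endpoints of its part in the positive orthant: one endpoint if the direction of the line is
  positive, otherwise none or two.
\<close>

lemma pos_comb_parity:
  fixes a :: "'v \<Rightarrow> 'e::real_vector"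
  assumes fin: "finite \<sigma>"
    and dep: "v0 \<in> \<sigma>" "\<mu> v0 \<noteq> 0" "(\<Sum>v\<in>\<sigma>. \<mu> v *\<^sub>R a v) = 0"
    and gen: "\<And>l u v. (\<Sum>v\<in>\<sigma>. l v *\<^sub>R a v) = w \<Longrightarrow> u \<in> \<sigma> \<Longrightarrow> v \<in> \<sigma> \<Longrightarrow> l u = 0 \<Longrightarrow> l v = 0 \<Longrightarrow> u = v"
    and H: "\<And>\<tau>. \<tau> \<subset> \<sigma> \<Longrightarrow> \<tau> \<noteq> {} \<Longrightarrow> \<not> pos_comb a \<tau> 0"
    and sp: "pos_comb a \<sigma> 0 \<Longrightarrow> w \<in> span (a ` \<sigma>)"
  shows "odd (card {v \<in> \<sigma>. pos_comb a (\<sigma> - {v}) w}) \<longleftrightarrow> pos_comb a \<sigma> 0"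
proof -
  let ?N = "{v \<in> \<sigma>. pos_comb a (\<sigma> - {v}) w}"
  have N_I: "v \<in> ?N" if v: "v \<in> \<sigma>" "l v = 0" "\<And>u. u \<in> \<sigma> \<Longrightarrow> 0 \<le> l u"
    "(\<Sum>v\<in>\<sigma>. l v *\<^sub>R a v) = w" for v l
  proof -
    have "0 < l u" if "u \<in> \<sigma> - {v}" for u
      using that v(3)[of u] gen[OF v(4), of u v] v(1,2) by (metis DiffE insertCI less_le)
    moreover have "(\<Sum>v\<in>\<sigma> - {v}. l v *\<^sub>R a v) = w"
      using v fin by (simp add: sum.remove[of \<sigma> v])
    ultimately show ?thesis using v(1) by (auto simp: pos_comb_def)
  qed
  have N_D: "\<exists>l. l v = 0 \<and> (\<forall>u\<in>\<sigma> - {v}. 0 < l u) \<and> (\<Sum>v\<in>\<sigma>. l v *\<^sub>R a v) = w"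
    if v: "v \<in> ?N" for v
  proof -
    obtain l where l: "\<And>u. u \<in> \<sigma> - {v} \<Longrightarrow> 0 < l u" "(\<Sum>v\<in>\<sigma> - {v}. l v *\<^sub>R a v) = w"
      using v by (auto simp: pos_comb_def)
    have "(\<Sum>u\<in>\<sigma>. (l(v := 0)) u *\<^sub>R a u) = w"
      using l(2) unfolding sum_fun_upd_zero[OF fin] .
    then show ?thesis using l(1) by (intro exI[of _ "l(v := 0)"]) auto
  qed
  show ?thesis
  proof (cases "?N = {}")
    case True
    have "\<not> pos_comb a \<sigma> 0"
    proof
      assume p: "pos_comb a \<sigma> 0"
      then obtain m where m: "\<And>v. v \<in> \<sigma> \<Longrightarrow> 0 < m v" "(\<Sum>v\<in>\<sigma>. m v *\<^sub>R a v) = 0"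
        by (auto simp: pos_comb_def)
      obtain l where l: "(\<Sum>v\<in>\<sigma>. l v *\<^sub>R a v) = w"
        using span_imageE[OF fin sp[OF p]] .
      \<comment> \<open>Large enough that shifting \<open>l\<close> by \<open>t\<close> times the
        positive dependency \<open>m\<close> makes it nonnegative. Moving back along
        \<open>- m\<close> until a coordinate vanishes then yields a member of the empty set
        \<open>?N\<close>.\<close>
      define t where "t = Max ((\<lambda>v. \<bar>l v\<bar> / m v) ` \<sigma>)"
      have t: "0 \<le> l v + t * m v" if v: "v \<in> \<sigma>" for v
      proof -
        have "\<bar>l v\<bar> / m v \<le> t" unfolding t_def using fin v by (intro Max_ge) auto
        then show ?thesis using m(1)[OF v] by (simp add: field_simps)
      qed
      obtain s x where s: "x \<in> \<sigma>" "l x + t * m x + s * - m x = 0"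
        "\<And>v. v \<in> \<sigma> \<Longrightarrow> 0 \<le> l v + t * m v + s * - m v"
        using ratio_test[OF fin dep(1), of "\<lambda>v. - m v" "\<lambda>v. l v + t * m v"] t m(1)[OF dep(1)]
        by (metis neg_less_0_iff_less)
      have "(\<Sum>v\<in>\<sigma>. - m v *\<^sub>R a v) = 0" using m(2) by (simp add: sum_negf)
      then have "(\<Sum>v\<in>\<sigma>. (l v + t * m v + s * - m v) *\<^sub>R a v) = w"
        unfolding sum_scale_add using l m(2) by simp
      then have "x \<in> ?N" using N_I[of x "\<lambda>v. l v + t * m v + s * - m v"] s by blast
      then show False using True by blast
    qed
    then show ?thesis unfolding True by simp
  next
    case False
    then obtain v l where vN: "v \<in> ?N" and l: "l v = 0" "\<And>u. u \<in> \<sigma> - {v} \<Longrightarrow> 0 < l u"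
      "(\<Sum>v\<in>\<sigma>. l v *\<^sub>R a v) = w" using N_D by blast
    have v: "v \<in> \<sigma>" using vN by simp
    \<comment> \<open>A dependency is determined by its value at \<open>v\<close>: if it vanished at
      \<open>v\<close> but not at \<open>u\<close>, some solution on the line through
      \<open>l\<close> would vanish at both, against genericity. Hence all solutions are
      \<open>l + t * m\<close>, where \<open>m\<close> is normalised to 1 at
      \<open>v\<close>.\<close>
    have zero: "n u = 0" if n: "(\<Sum>v\<in>\<sigma>. n v *\<^sub>R a v) = 0" "n v = 0" "u \<in> \<sigma>" for n u
    proof (rule ccontr)
      assume nu: "n u \<noteq> 0"
      define t where "t = - l u / n u"
      have s: "(\<Sum>x\<in>\<sigma>. (l x + t * n x) *\<^sub>R a x) = w"
        using l(3) n(1) by (simp only: sum_scale_add) simp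
      have "l v + t * n v = 0" "l u + t * n u = 0"
        using l(1) n(2) nu by (simp_all add: t_def)
      then have "v = u" using gen[OF s v n(3)] by simp
      then show False using n nu by simp
    qed
    define m where "m x = \<mu> x / \<mu> v" for x
    have mv: "\<mu> v \<noteq> 0" using zero[of \<mu> v0] dep by blast
    have "(\<Sum>x\<in>\<sigma>. m x *\<^sub>R a x) = (1 / \<mu> v) *\<^sub>R (\<Sum>x\<in>\<sigma>. \<mu> x *\<^sub>R a x)"
      by (simp add: m_def scaleR_sum_right)
    then have m: "m v = 1" "(\<Sum>x\<in>\<sigma>. m x *\<^sub>R a x) = 0"
      using mv dep(3) by (simp_all add: m_def)
    have multiple: "n u = n v * m u" if n: "(\<Sum>v\<in>\<sigma>. n v *\<^sub>R a v) = 0" "u \<in> \<sigma>" for n u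
      using zero[of "\<lambda>x. n x + (- n v) * m x" u] n m by (simp only: sum_scale_add) simp
    \<comment> \<open>Any further endpoint lies on the same line at a positive parameter, namely its
      coefficient at \<open>v\<close>.\<close>
    have other: "\<exists>t>0. l x + t * m x = 0 \<and> (\<forall>u\<in>\<sigma> - {x}. 0 < l u + t * m u)"
      if x: "x \<in> ?N" "x \<noteq> v" for x
    proof -
      obtain k where k: "k x = 0" "\<And>u. u \<in> \<sigma> - {x} \<Longrightarrow> 0 < k u" "(\<Sum>v\<in>\<sigma>. k v *\<^sub>R a v) = w"
        using N_D[OF x(1)] by blast
      have "k u + (-1) * l u = (k v + (-1) * l v) * m u" if "u \<in> \<sigma>" for u
        using that k(3) l(3) by (intro multiple[of "\<lambda>u. k u + (-1) * l u"]) (simp_all only: sum_scale_add, simp)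
      then have "k u = l u + k v * m u" if "u \<in> \<sigma>" for u using that l(1) by force
      moreover have "0 < k v" using k(2) v x(2) by blast
      ultimately show ?thesis using k(1,2) x(1) by (intro exI[of _ "k v"]) auto
    qed
    show ?thesis
    proof (cases "\<exists>u\<in>\<sigma>. m u < 0")
      \<comment> \<open>The direction is nonnegative, hence positive by minimality, and the ray from
        \<open>l\<close> never leaves the orthant: \<open>v\<close> is the only endpoint.\<close>
      case False
      have mpos: "0 < m u" if "u \<in> \<sigma>" for u
        using False m v H that by (intro nonneg_dependency_pos[OF fin _ m(2) v _ H]) force+
      then have "pos_comb a \<sigma> 0" using m(2) by (auto simp: pos_comb_def)
      moreover have "?N = {v}"
      proof -
        have "x = v" if x: "x \<in> ?N" for x
        proof (rule ccontr)
          assume xv: "x \<noteq> v"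
          then obtain t where t: "0 < t" "l x + t * m x = 0" using other[OF x] by blast
          have "0 < l x" "0 < m x" using x xv l(2) mpos by auto
          then show False using t by (smt (verit) mult_pos_pos)
        qed
        then show ?thesis using vN by blast
      qed
      ultimately show ?thesis by simp
    next
      case True
      then obtain u where u: "u \<in> \<sigma>" "m u < 0" by blast
      have l0: "0 \<le> l x" if "x \<in> \<sigma>" for x using l(1) l(2)[of x] that by (cases "x = v") auto
      \<comment> \<open>The ray leaves the orthant at parameter \<open>t\<close>, where coordinate
        \<open>x\<close> vanishes.\<close>
      obtain t x where t: "0 \<le> t" "x \<in> \<sigma>" "m x < 0" "l x + t * m x = 0"
        "\<And>y. y \<in> \<sigma> \<Longrightarrow> 0 \<le> l y + t * m y"
        using ratio_test[of \<sigma> u m l, OF fin u l0] by metis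
      have xv: "x \<noteq> v" using t(3) m(1) by auto
      have xN: "x \<in> ?N"
        by (rule N_I[where l = "\<lambda>x. l x + t * m x"]) (use t l m in \<open>auto simp: sum_scale_add\<close>)
      \<comment> \<open>An endpoint \<open>y\<close> other than \<open>x\<close> would be reached at
        some \<open>s < t\<close>, so its coordinate would already be negative at
        \<open>t\<close>.\<close>
      have "y = x" if y: "y \<in> ?N" "y \<noteq> v" for y
      proof (rule ccontr)
        assume yx: "y \<noteq> x"
        obtain s where s: "0 < s" "l y + s * m y = 0" "0 < l x + s * m x"
          using other[OF y] t(2) yx by blast
        have "s < t" using s(3) t(3,4) by (smt (verit) mult_le_cancel_right)
        have ly: "0 < l y" using l(2) y by blast
        then have "m y < 0" using s by (smt (verit) mult_nonneg_nonneg)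
        then have "t * m y < s * m y" using \<open>s < t\<close> by simp
        then show False using t(5)[of y] s(2) y by simp
      qed
      then have "?N = {v, x}" using vN xN by blast
      \<comment> \<open>Every dependency is a multiple of \<open>m\<close>, which takes both
        signs.\<close>
      moreover have "\<not> pos_comb a \<sigma> 0"
      proof
        assume "pos_comb a \<sigma> 0"
        then obtain n where n: "\<And>v. v \<in> \<sigma> \<Longrightarrow> 0 < n v" "(\<Sum>v\<in>\<sigma>. n v *\<^sub>R a v) = 0"
          by (auto simp: pos_comb_def)
        show False using multiple[OF n(2) u(1)] n(1)[OF u(1)] n(1)[OF v] u(2)
          by (smt (verit) mult_pos_neg)
      qed
      ultimately show ?thesis using xv by simp
    qed
  qed
qed

section \<open>Generic directions\<close>

text \<open>Induction on the family. If the point \<open>w\<close> found so far lies in the new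
  subspace \<open>U\<close>, take \<open>u\<close> in \<open>W\<close> outside \<open>U\<close>:
  then \<open>u + t *\<^sub>R w\<close> avoids \<open>U\<close> for all \<open>t\<close>, and each
  old subspace for all but at most one \<open>t\<close>, since two such values would put
  \<open>w\<close> itself there.\<close>

lemma avoid_finitely_many_subspaces:
  fixes W :: "'e::real_vector set"
  assumes "finite F" and W: "subspace W" and "\<And>U. U \<in> F \<Longrightarrow> subspace U \<and> \<not> W \<subseteq> U"
  shows "\<exists>w\<in>W. \<forall>U\<in>F. w \<notin> U"
  using assms(1,3)
proof (induction F rule: finite_induct)
  case empty
  then show ?case using subspace_0[OF W] by blast
next
  case (insert U F)
  then obtain w where w: "w \<in> W" "\<And>U'. U' \<in> F \<Longrightarrow> w \<notin> U'" by blast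
  obtain u where u: "u \<in> W" "u \<notin> U" using insert.prems by blast
  have U: "subspace U" using insert.prems by blast
  show ?case
  proof (cases "w \<in> U")
    case True
    have fin: "finite {t. u + t *\<^sub>R w \<in> U'}" if "U' \<in> F" for U'
    proof -
      have U': "subspace U'" using that insert.prems by blast
      have "s = t" if "u + s *\<^sub>R w \<in> U'" "u + t *\<^sub>R w \<in> U'" for s t
      proof (rule ccontr)
        assume st: "s \<noteq> t"
        have "(u + s *\<^sub>R w) - (u + t *\<^sub>R w) \<in> U'" using U' that subspace_diff by blast
        then have "(1 / (s - t)) *\<^sub>R ((s - t) *\<^sub>R w) \<in> U'"
          using subspace_scale[OF U'] by (simp add: scaleR_diff_left)
        then show False using st w(2)[OF \<open>U' \<in> F\<close>] by simp
      qed
      then have "{t. u + t *\<^sub>R w \<in> U'} \<subseteq> {SOME t. u + t *\<^sub>R w \<in> U'}"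
        by (auto intro: someI2)
      then show ?thesis by (rule finite_subset) simp
    qed
    obtain t where t: "t \<notin> (\<Union>U'\<in>F. {t. u + t *\<^sub>R w \<in> U'})"
      using ex_new_if_finite[OF infinite_UNIV_char_0, of "\<Union>U'\<in>F. {t. u + t *\<^sub>R w \<in> U'}"]
        fin insert.hyps(1) by blast
    have "u + t *\<^sub>R w \<notin> U"
    proof
      assume "u + t *\<^sub>R w \<in> U"
      then have "(u + t *\<^sub>R w) - t *\<^sub>R w \<in> U"
        using U True by (intro subspace_diff subspace_scale)
      then show False using u by simp
    qed
    moreover have "u + t *\<^sub>R w \<in> W" using W u w by (intro subspace_add subspace_scale)
    ultimately show ?thesis using t by blast
  qed (use w in blast)
qed

lemma generic_point:
  fixes a :: "'v::finite \<Rightarrow> 'e::euclidean_space"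
  assumes W: "subspace W"
  obtains w where "w \<in> W" "\<And>\<tau>. card \<tau> < dim W \<Longrightarrow> w \<notin> span (a ` \<tau>)"
proof -
  have "\<not> W \<subseteq> span (a ` \<tau>)" if "card \<tau> < dim W" for \<tau>
  proof
    assume "W \<subseteq> span (a ` \<tau>)"
    then have "dim W \<le> dim (a ` \<tau>)" by (metis dim_span dim_subset)
    also have "\<dots> \<le> card \<tau>" using dim_le_card'[of "a ` \<tau>"] card_image_le[of \<tau> a] by simp
    finally show False using that by simp
  qed
  then have "\<exists>w\<in>W. \<forall>U\<in>(\<lambda>\<tau>. span (a ` \<tau>)) ` {\<tau>. card \<tau> < dim W}. w \<notin> U"
    by (intro avoid_finitely_many_subspaces W) auto
  then show ?thesis using that by auto
qed

section \<open>A face of the matroidal complex that covers the origin\<close>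

lemma convex_hull_image_pos_comb:
  fixes a :: "'v \<Rightarrow> 'e::real_vector"
  assumes "x \<in> convex hull (a ` \<sigma>)"
  obtains \<tau> where "\<tau> \<subseteq> \<sigma>" "\<tau> \<noteq> {}" "pos_comb a \<tau> x"
proof -
  obtain B u where B: "finite B" "B \<subseteq> a ` \<sigma>" "\<And>y. y \<in> B \<Longrightarrow> 0 \<le> u y" "sum u B = 1"
    "(\<Sum>y\<in>B. u y *\<^sub>R y) = x"
    using assms by (auto simp: convex_hull_explicit)
  define C where "C = {y \<in> B. u y \<noteq> 0}"
  have "C \<noteq> {}" using B(4) by (force simp: C_def)
  obtain \<tau> where \<tau>: "\<tau> \<subseteq> \<sigma>" "inj_on a \<tau>" "C = a ` \<tau>"
    using B(2) subset_image_inj[of C a \<sigma>] by (auto simp: C_def)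
  have "(\<Sum>y\<in>C. u y *\<^sub>R y) = x"
    unfolding B(5)[symmetric] C_def using B(1) by (intro sum.mono_neutral_left) auto
  then have "(\<Sum>v\<in>\<tau>. u (a v) *\<^sub>R a v) = x" using \<tau> by (simp add: sum.reindex)
  moreover have "0 < u (a v)" if "v \<in> \<tau>" for v
  proof -
    have "a v \<in> C" using that \<tau>(3) by blast
    then show ?thesis using B(3)[of "a v"] by (auto simp: C_def)
  qed
  ultimately have "pos_comb a \<tau> x" unfolding pos_comb_def by (intro exI[of _ "\<lambda>v. u (a v)"]) blast
  moreover have "\<tau> \<noteq> {}" using \<tau>(3) \<open>C \<noteq> {}\<close> by blast
  ultimately show ?thesis using that \<tau>(1) by blast
qed

text \<open>Outside the set \<open>S0\<close> of elements that extend \<tau>, the face \<tau> is a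
  facet. Purity makes \<open>card \<tau>\<close> the rank of the complement of \<open>S0\<close>, so
  \<open>S0\<close> satisfies the rank condition and contains a minimal set that does.\<close>

lemma cocircuit_of_extensions:
  fixes V :: "'v::finite set"
  assumes M: "matroidal V M" and \<tau>: "\<tau> \<in> M" "int (card \<tau>) < rank_fun M V"
  obtains S where "cocircuit V M S" "\<And>v. v \<in> S \<Longrightarrow> insert v \<tau> \<in> M"
proof -
  have sc: "simplicial_complex_on V M" using M by (simp add: matroidal_def)
  define S0 where "S0 = {v \<in> V. v \<notin> \<tau> \<and> insert v \<tau> \<in> M}"
  define K where "K = induced_complex M (V - S0)"
  have "finite K" by simp
  have \<tau>K: "\<tau> \<in> K"
    using \<tau>(1) sc by (auto simp: K_def induced_complex_def S0_def simplicial_complex_on_def)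
  have facet: "\<tau> \<in> facets K"
  proof -
    have "\<rho> = \<tau>" if \<rho>: "\<rho> \<in> K" "\<tau> \<subseteq> \<rho>" for \<rho>
    proof (rule ccontr)
      assume "\<rho> \<noteq> \<tau>"
      then obtain v where v: "v \<in> \<rho>" "v \<notin> \<tau>" using \<rho>(2) by blast
      then have "insert v \<tau> \<subseteq> \<rho>" using \<rho>(2) by blast
      then have "insert v \<tau> \<in> M"
        using \<rho>(1) sc by (auto simp: K_def induced_complex_def simplicial_complex_on_def)
      then show False using v \<rho>(1) by (auto simp: K_def induced_complex_def S0_def)
    qed
    then show ?thesis using \<tau>K by (auto simp: facets_def)
  qed
  have pure: "pure_complex K" using M by (auto simp: matroidal_def K_def)
  have "face_dim \<rho> \<le> face_dim \<tau>" if \<rho>: "\<rho> \<in> K" for \<rho>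
  proof -
    obtain m where m: "m \<in> K" "\<rho> \<subseteq> m" "\<And>b. b \<in> K \<Longrightarrow> m \<subseteq> b \<Longrightarrow> m = b"
      using finite_has_maximal2[of K \<rho>] \<open>finite K\<close> \<rho> by blast
    then have "m \<in> facets K" by (auto simp: facets_def)
    then have "face_dim m = face_dim \<tau>" using pure facet unfolding pure_complex_def by blast
    then show ?thesis using card_mono[OF finite m(2)] by (simp add: face_dim_def)
  qed
  then have "complex_dim K \<le> face_dim \<tau>"
    unfolding complex_dim_def using \<tau>K by (subst Max_le_iff) auto
  then have "rank_fun M (V - S0) \<le> rank_fun M V - 1"
    using \<tau>(2) by (simp add: rank_fun_def K_def[symmetric] face_dim_def)
  moreover define Q where "Q = {S. S \<subseteq> V \<and> rank_fun M (V - S) \<le> rank_fun M V - 1}"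
  ultimately have "S0 \<in> Q" by (auto simp: S0_def)
  then obtain S where S: "S \<in> Q" "S \<subseteq> S0" "\<forall>S'\<in>Q. S' \<subseteq> S \<longrightarrow> S = S'"
    using finite_has_minimal2[of Q S0] by (meson finite)
  have "cocircuit V M S" unfolding cocircuit_def using S unfolding Q_def by blast
  then show ?thesis using that S(2) by (auto simp: S0_def)
qed

text \<open>All points of \<open>B\<close> satisfy \<open>p \<bullet> p \<le> p \<bullet> x\<close>,
  so those with positive weight in \<open>p\<close> lie on the hyperplane of equality. It misses 0,
  hence the affine dimension there is less than \<open>dim W\<close>, and Caratheodory's theorem
  saves one point.\<close>

lemma closest_point_carrier:
  fixes B :: "'e::euclidean_space set"
  assumes fin: "finite B" and ne: "B \<noteq> {}" and W: "subspace W" "B \<subseteq> W"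
    and p: "p = closest_point (convex hull B) 0" "p \<noteq> 0"
  obtains C where "C \<subseteq> B" "card C \<le> dim W" "p \<in> convex hull C"
proof -
  define H where "H = {x \<in> B. p \<bullet> x = p \<bullet> p}"
  have cl: "closed (convex hull B)" "convex hull B \<noteq> {}"
    using fin ne by (auto intro: compact_imp_closed finite_imp_compact_convex_hull)
  have pB: "p \<in> convex hull B" using closest_point_in_set[OF cl] p(1) by simp
  have ge: "p \<bullet> p \<le> p \<bullet> x" if "x \<in> B" for x
    using closest_point_dot[OF convex_convex_hull cl(1) hull_inc[OF that], of 0] p(1)
    by (simp add: inner_diff_right)
  obtain u where u: "\<And>x. x \<in> B \<Longrightarrow> 0 \<le> u x" "sum u B = 1" "(\<Sum>x\<in>B. u x *\<^sub>R x) = p"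
    using pB fin by (auto simp: convex_hull_finite)
  have "(\<Sum>x\<in>B. u x * (p \<bullet> x - p \<bullet> p)) = p \<bullet> (\<Sum>x\<in>B. u x *\<^sub>R x) - sum u B * (p \<bullet> p)"
    by (simp add: right_diff_distrib sum_subtractf inner_sum_right sum_distrib_right)
  then have "(\<Sum>x\<in>B. u x * (p \<bullet> x - p \<bullet> p)) = 0" using u by simp
  then have "\<forall>x\<in>B. u x * (p \<bullet> x - p \<bullet> p) = 0"
    using fin u(1) ge by (subst (asm) sum_nonneg_eq_0_iff) auto
  then have "\<forall>x\<in>B - H. u x = 0" by (auto simp: H_def)
  then have "(\<Sum>x\<in>H. u x *\<^sub>R x) = p" "sum u H = 1"
    unfolding u(2,3)[symmetric] using fin by (auto simp: H_def intro!: sum.mono_neutral_left)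
  then have pH: "p \<in> convex hull H"
    using fin u(1) unfolding convex_hull_explicit
    by (intro CollectI exI[of _ H] exI[of _ u]) (auto simp: H_def)
  have "affine hull H \<subseteq> {x. p \<bullet> x = p \<bullet> p}"
    by (intro hull_minimal) (auto simp: H_def affine_hyperplane)
  then have "0 \<notin> affine hull H" using p(2) by auto
  then have "aff_dim (insert 0 H) = aff_dim H + 1" by (simp add: aff_dim_insert)
  moreover have "aff_dim (insert 0 H) \<le> aff_dim W"
    using W by (intro aff_dim_subset) (auto simp: H_def subspace_0)
  ultimately have "aff_dim H + 1 \<le> int (dim W)" using W by (simp add: aff_dim_subspace)
  moreover obtain C where "C \<subseteq> H" "int (card C) \<le> aff_dim H + 1" "p \<in> convex hull C"
    using pH caratheodory_aff_dim[of H] by auto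
  ultimately show ?thesis using that[of C] by (auto simp: H_def)
qed

lemma matroidal_Caratheodory:
  fixes a :: "'v::finite \<Rightarrow> 'e::euclidean_space"
  assumes M: "matroidal V M" and r: "rank_fun M V = int (dim W) + 1"
    and W: "subspace W" "a ` V \<subseteq> W"
    and co: "\<And>S. cocircuit V M S \<Longrightarrow> pos_comb a S 0"
  shows "\<exists>\<sigma>\<in>M. \<sigma> \<noteq> {} \<and> pos_comb a \<sigma> 0"
proof -
  have sc: "\<And>\<sigma>. \<sigma> \<in> M \<Longrightarrow> \<sigma> \<subseteq> V" "\<And>\<sigma> \<tau>. \<sigma> \<in> M \<Longrightarrow> \<tau> \<subseteq> \<sigma> \<Longrightarrow> \<tau> \<in> M"
    using M by (auto simp: matroidal_def simplicial_complex_on_def)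
  define F where "F = M - {{}}"
  define f where "f \<sigma> = closest_point (convex hull (a ` \<sigma>)) 0" for \<sigma>
  \<comment> \<open>Positive rank excludes the complex whose only face is empty.\<close>
  have "F \<noteq> {}"
  proof
    assume "F = {}"
    moreover have "{} \<in> M" using M by (auto simp: matroidal_def simplicial_complex_on_def)
    ultimately have "induced_complex M V = {{}}" by (auto simp: F_def induced_complex_def)
    then show False using r by (simp add: rank_fun_def complex_dim_def face_dim_def)
  qed
  then obtain \<sigma> where \<sigma>: "\<sigma> \<in> F" "\<And>\<tau>. \<tau> \<in> F \<Longrightarrow> norm (f \<sigma>) \<le> norm (f \<tau>)"
    using arg_min_if_finite(1)[of F "\<lambda>\<sigma>. norm (f \<sigma>)"] arg_min_least[of F _ "\<lambda>\<sigma>. norm (f \<sigma>)"]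
    by (metis finite)
  have min: "norm (f \<sigma>) \<le> norm x" if "\<tau> \<in> F" "x \<in> convex hull (a ` \<tau>)" for \<tau> x
  proof -
    have "closed (convex hull (a ` \<tau>))"
      by (intro compact_imp_closed finite_imp_compact_convex_hull) simp
    then have "norm (f \<tau>) \<le> norm x"
      using closest_point_le[OF _ that(2), of 0] by (simp add: f_def)
    then show ?thesis using \<sigma>(2)[OF that(1)] by simp
  qed
  have "f \<sigma> = 0"
  proof (rule ccontr)
    assume nz: "f \<sigma> \<noteq> 0"
    have "a ` \<sigma> \<subseteq> W" using W(2) sc(1) \<sigma>(1) by (auto simp: F_def)
    then obtain C where C: "C \<subseteq> a ` \<sigma>" "card C \<le> dim W" "f \<sigma> \<in> convex hull C"
      using closest_point_carrier[of "a ` \<sigma>" W "f \<sigma>"] W(1) nz \<sigma>(1) by (auto simp: f_def F_def)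
    \<comment> \<open>One vertex over each point of \<open>C\<close>, so that \<tau> inherits the
      bound on \<open>card C\<close>.\<close>
    obtain \<tau> where \<tau>: "\<tau> \<subseteq> \<sigma>" "inj_on a \<tau>" "C = a ` \<tau>"
      using C(1) subset_image_inj[of C a \<sigma>] by auto
    have \<tau>M: "\<tau> \<in> M" using sc(2) \<sigma>(1) \<tau>(1) by (auto simp: F_def)
    have "int (card \<tau>) < rank_fun M V" using C(2) \<tau> r by (simp add: card_image)
    then obtain S where S: "cocircuit V M S" "\<And>v. v \<in> S \<Longrightarrow> insert v \<tau> \<in> M"
      using cocircuit_of_extensions[OF M \<tau>M] by blast
    have "S \<noteq> {}" using S(1) by (auto simp: cocircuit_def)
    obtain u where u: "\<And>v. v \<in> S \<Longrightarrow> 0 < u v" "(\<Sum>v\<in>S. u v *\<^sub>R a v) = 0"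
      using co[OF S(1)] by (auto simp: pos_comb_def)
    \<comment> \<open>The vectors of \<open>S\<close> have a vanishing positive combination, so they
      cannot all have positive inner product with \<open>f \<sigma>\<close>.\<close>
    obtain v where v: "v \<in> S" "f \<sigma> \<bullet> a v \<le> 0"
    proof (rule ccontr)
      assume "\<not> thesis"
      then have "0 < (\<Sum>v\<in>S. u v * (f \<sigma> \<bullet> a v))"
        using that u(1) \<open>S \<noteq> {}\<close> by (intro sum_pos mult_pos_pos) force+
      moreover have "(\<Sum>v\<in>S. u v * (f \<sigma> \<bullet> a v)) = f \<sigma> \<bullet> (\<Sum>v\<in>S. u v *\<^sub>R a v)"
        by (simp add: inner_sum_right)
      ultimately show False using u(2) by simp
    qed
    \<comment> \<open>At \<open>f \<sigma>\<close> the directions to 0 and to \<open>a v\<close>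
      form an acute angle, so a short step toward \<open>a v\<close> comes closer to 0.\<close>
    have "0 < (0 - f \<sigma>) \<bullet> (a v - f \<sigma>)"
      using v(2) nz by (simp add: inner_diff_right add_pos_nonneg less_le_trans[OF _ v(2)] field_simps)
        (metis inner_gt_zero_iff le_less_trans)
    then obtain t where t: "0 < t" "t \<le> 1" "dist (f \<sigma> + t *\<^sub>R (a v - f \<sigma>)) 0 < dist (f \<sigma>) 0"
      using closer_point_lemma by blast
    have "convex hull C \<subseteq> convex hull (a ` insert v \<tau>)" using \<tau>(3) by (intro hull_mono) auto
    then have "(1 - t) *\<^sub>R f \<sigma> + t *\<^sub>R a v \<in> convex hull (a ` insert v \<tau>)"
      using t C(3) by (intro convexD[OF convex_convex_hull]) (auto intro: hull_inc)
    then have "norm (f \<sigma>) \<le> norm ((1 - t) *\<^sub>R f \<sigma> + t *\<^sub>R a v)"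
      using S(2)[OF v(1)] by (intro min) (auto simp: F_def)
    then show False using t(3) by (simp add: algebra_simps)
  qed
  moreover have "f \<sigma> \<in> convex hull (a ` \<sigma>)"
    unfolding f_def using \<sigma>(1)
    by (intro closest_point_in_set compact_imp_closed finite_imp_compact_convex_hull) (auto simp: F_def)
  ultimately obtain \<tau> where "\<tau> \<subseteq> \<sigma>" "\<tau> \<noteq> {}" "pos_comb a \<tau> 0"
    using convex_hull_image_pos_comb by metis
  then show ?thesis using sc(2) \<sigma>(1) by (auto simp: F_def)
qed

section \<open>Cycles of the spanning tree and the parity count\<close>

text \<open>A solution with two vanishing coefficients would put \<open>w\<close> in the span of
  \<open>dim W - 1\<close> of the vectors, so avoiding the small spans provides the genericity
  needed for pivoting.\<close>

lemma pos_comb_parity_generic: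
  fixes a :: "'v \<Rightarrow> 'e::euclidean_space"
  assumes fin: "finite \<sigma>" and c: "card \<sigma> = Suc (dim W)"
    and W: "subspace W" "a ` \<sigma> \<subseteq> W" "w \<in> W"
    and gen: "\<And>\<tau>. card \<tau> < dim W \<Longrightarrow> w \<notin> span (a ` \<tau>)"
    and H: "\<And>\<tau>. \<tau> \<subset> \<sigma> \<Longrightarrow> \<tau> \<noteq> {} \<Longrightarrow> \<not> pos_comb a \<tau> 0"
  shows "odd (card {v \<in> \<sigma>. pos_comb a (\<sigma> - {v}) w}) \<longleftrightarrow> pos_comb a \<sigma> 0"
proof -
  have "dim (a ` \<sigma>) < card \<sigma>" using c dim_subset[OF W(2)] by simp
  then obtain \<mu> v where "v \<in> \<sigma>" "\<mu> v \<noteq> 0" "(\<Sum>v\<in>\<sigma>. \<mu> v *\<^sub>R a v) = 0"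
    using dependent_family[OF fin] by metis
  then show ?thesis
  proof (rule pos_comb_parity[OF fin _ _ _ _ H])
    show "w \<in> span (a ` \<sigma>)" if "pos_comb a \<sigma> 0"
      using minimal_dependency_spans[OF fin c W(1,2) H that] W(3) by blast
    show "u = v" if l: "(\<Sum>v\<in>\<sigma>. l v *\<^sub>R a v) = w" "u \<in> \<sigma>" "v \<in> \<sigma>" "l u = 0" "l v = 0" for l u v
    proof (rule ccontr)
      assume uv: "u \<noteq> v"
      have "w = (\<Sum>x\<in>\<sigma> - {u, v}. l x *\<^sub>R a x)"
        unfolding l(1)[symmetric] using fin l(4,5) by (intro sum.mono_neutral_right) auto
      also have "\<dots> \<in> span (a ` (\<sigma> - {u, v}))"
        by (intro span_sum span_scale span_base) auto
      finally have "\<not> card (\<sigma> - {u, v}) < dim W" using gen by blast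
      moreover have "card (\<sigma> - {u, v}) = card \<sigma> - 2"
        using uv l(2,3) fin by (simp add: card_Diff_subset)
      \<comment> \<open>Guards the truncated subtraction; it also excludes
        \<open>dim W = 0\<close>.\<close>
      moreover have "2 \<le> card \<sigma>"
        using uv l(2,3) fin card_mono[of \<sigma> "{u, v}"] by simp
      ultimately show False using c by simp
    qed
  qed
qed

text \<open>The coboundary of the cochain \<open>b\<close> pairs to zero with a cycle: exchanging
  the sums moves the boundary onto \<open>z\<close>.\<close>

lemma sum_over_cycle_eq_0:
  fixes b :: "'a set \<Rightarrow> bit"
  assumes "finite K" and z: "z \<in> cycles k K"
  shows "(\<Sum>\<sigma>\<in>faces_of_dim K k. z \<sigma> * (\<Sum>\<tau> | \<tau> \<in> faces_of_dim K (k - 1) \<and> \<tau> \<subseteq> \<sigma>. b \<tau>)) = 0"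
proof -
  have fin: "finite (faces_of_dim K j)" for j
    using assms(1) by (simp add: faces_of_dim_def)
  have "(\<Sum>\<sigma>\<in>faces_of_dim K k. z \<sigma> * (\<Sum>\<tau> | \<tau> \<in> faces_of_dim K (k - 1) \<and> \<tau> \<subseteq> \<sigma>. b \<tau>)) =
      (\<Sum>\<tau>\<in>faces_of_dim K (k - 1). \<Sum>\<sigma> | \<sigma> \<in> faces_of_dim K k \<and> \<tau> \<subseteq> \<sigma>. z \<sigma> * b \<tau>)"
    unfolding sum_distrib_left using fin by (subst sum.swap_restrict) auto
  also have "\<dots> = (\<Sum>\<tau>\<in>faces_of_dim K (k - 1). boundary_map k K z \<tau> * b \<tau>)"
    by (simp add: boundary_map_def sum_distrib_right)
  also have "\<dots> = 0" using z by (simp add: cycles_def)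
  finally show ?thesis .
qed

text \<open>With no faces above dimension \<open>d\<close>, homology in degree \<open>d\<close>
  consists of the cycles themselves. Adding \<open>s\<close> creates a nonzero one, and it must use
  \<open>s\<close>, as otherwise it would be a cycle of \<open>T\<close>.\<close>

lemma spanning_tree_cycle:
  assumes M: "simplicial_complex_on V M" "finite M"
    and dimM: "\<And>\<sigma>. \<sigma> \<in> M \<Longrightarrow> card \<sigma> \<le> Suc d"
    and T: "Z2_spanning_tree d M T" and s: "s \<in> M" "s \<notin> T"
  obtains z where "z \<in> cycles (int d) (insert s T)" "z s = 1"
proof -
  have TM: "T \<subseteq> M" and scT: "simplicial_complex_on (\<Union>M) T"
    and skel: "\<And>\<sigma>. \<sigma> \<in> M \<Longrightarrow> card \<sigma> \<le> d \<Longrightarrow> \<sigma> \<in> T"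
    and trT: "trivial_group (reduced_homology (int d) T)"
    using T by (auto simp: Z2_spanning_tree_def face_dim_def)
  let ?K = "insert s T"
  have sub: "\<And>\<sigma> \<tau>. \<sigma> \<in> M \<Longrightarrow> \<tau> \<subseteq> \<sigma> \<Longrightarrow> \<tau> \<in> M" and fs: "finite s"
    using M(1) s by (auto simp: simplicial_complex_on_def)
  \<comment> \<open>\<open>T\<close> contains every smaller face, so a face outside \<open>T\<close>
    has the top dimension.\<close>
  have cs: "card s = Suc d" using skel[OF s(1)] s dimM[OF s(1)] by linarith
  have "s \<in> facets M"
    unfolding facets_def
  proof (intro CollectI conjI ballI impI)
    fix \<tau> assume "\<tau> \<in> M" "s \<subseteq> \<tau>"
    then show "\<tau> = s"
      using card_seteq[of \<tau> s] dimM[of \<tau>] cs M(1) by (auto simp: simplicial_complex_on_def)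
  qed (rule s(1))
  then have ntr: "\<not> trivial_group (reduced_homology (int d) ?K)"
    using T s by (auto simp: Z2_spanning_tree_def)
  have face_s: "\<tau> \<in> ?K" if "\<tau> \<subseteq> s" for \<tau>
  proof (cases "\<tau> = s")
    case False
    then have "\<tau> \<subset> s" using that by blast
    then have "card \<tau> \<le> d" using psubset_card_mono[OF fs, of \<tau>] cs by simp
    then show ?thesis using skel sub[OF s(1) that] by simp
  qed simp
  have scK: "simplicial_complex_on (\<Union>M) ?K"
    unfolding simplicial_complex_on_def
  proof (intro conjI ballI allI impI)
    show "{} \<in> ?K" using scT by (simp add: simplicial_complex_on_def)
    show "finite \<sigma>" "\<sigma> \<subseteq> \<Union>M" if "\<sigma> \<in> ?K" for \<sigma>
      using that scT fs s(1) by (auto simp: simplicial_complex_on_def)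
    show "\<tau> \<in> ?K" if "\<sigma> \<in> ?K" "\<tau> \<subseteq> \<sigma>" for \<sigma> \<tau>
    proof (cases "\<sigma> = s")
      case False
      then show ?thesis using that scT unfolding simplicial_complex_on_def by blast
    qed (use that face_s in simp)
  qed
  have finT: "finite T" using M(2) TM finite_subset by blast
  have no_bd: "boundaries (int d) L = {\<lambda>_. 0}" if "L \<subseteq> M" for L
  proof -
    have "faces_of_dim L (int d + 1) = {}"
      using that dimM by (force simp: faces_of_dim_def face_dim_def)
    then have "boundary_map (int d + 1) L c = (\<lambda>_. 0)" for c
      by (auto simp: boundary_map_def)
    moreover have "(\<lambda>_. 0) \<in> chains (int d + 1) L" by (simp add: chains_def)
    ultimately show ?thesis by (auto simp: boundaries_def)
  qed
  have cT: "cycles (int d) T = {\<lambda>_. 0}"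
    using trivial_reduced_homology_iff[OF scT finT] trT no_bd[OF TM] by simp
  have "cycles (int d) ?K \<noteq> {\<lambda>_. 0}"
    using trivial_reduced_homology_iff[OF scK, of "int d"] finT ntr no_bd[of ?K] TM s(1) by simp
  moreover have "(\<lambda>_. 0) \<in> cycles (int d) ?K"
    by (auto simp: cycles_def chains_def boundary_map_def)
  ultimately obtain z where z: "z \<in> cycles (int d) ?K" "z \<noteq> (\<lambda>_. 0)" by blast
  have "z s \<noteq> 0"
  proof
    assume zs: "z s = 0"
    have "boundary_map (int d) T z \<tau> = 0" for \<tau>
    proof (cases "\<tau> \<in> faces_of_dim T (int d - 1)")
      case True
      have "boundary_map (int d) T z \<tau> = boundary_map (int d) ?K z \<tau>"
        using True finT zs by (auto simp: boundary_map_def faces_of_dim_def intro!: sum.mono_neutral_left)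
      then show ?thesis using z(1) by (simp add: cycles_def)
    qed (simp add: boundary_map_def)
    moreover have "z \<in> chains (int d) T"
      using z(1) zs by (auto simp: cycles_def chains_def faces_of_dim_def)
    ultimately have "z \<in> cycles (int d) T" by (auto simp: cycles_def)
    then show False using cT z(2) by simp
  qed
  then have "z s = 1" by simp
  then show ?thesis using that z(1) by blast
qed

lemma of_nat_bit_eq_odd: "(of_nat n :: bit) = of_bool (odd n)"
  by (induction n) auto

text \<open>Deleting a vertex is a bijection onto the faces of codimension one, and a count taken in
  \<open>bit\<close> keeps only its parity.\<close>

lemma facet_sum_eq_card:
  assumes K: "simplicial_complex_on V K" and s: "\<sigma> \<in> faces_of_dim K k"
  shows "(\<Sum>\<tau> | \<tau> \<in> faces_of_dim K (k - 1) \<and> \<tau> \<subseteq> \<sigma>. of_bool (P \<tau>) :: bit) =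
    of_bool (odd (card {v \<in> \<sigma>. P (\<sigma> - {v})}))"
proof -
  have fs: "finite \<sigma>" and sub: "\<And>\<tau>. \<tau> \<subseteq> \<sigma> \<Longrightarrow> \<tau> \<in> K" and cs: "int (card \<sigma>) = k + 1"
    using K s by (auto simp: simplicial_complex_on_def faces_of_dim_def face_dim_def)
  have "{\<tau>. \<tau> \<in> faces_of_dim K (k - 1) \<and> \<tau> \<subseteq> \<sigma>} = (\<lambda>v. \<sigma> - {v}) ` \<sigma>"
  proof (intro equalityI subsetI)
    fix \<tau> assume "\<tau> \<in> {\<tau>. \<tau> \<in> faces_of_dim K (k - 1) \<and> \<tau> \<subseteq> \<sigma>}"
    then have t: "\<tau> \<subseteq> \<sigma>" "int (card \<tau>) = k" by (auto simp: faces_of_dim_def face_dim_def)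
    then have "card (\<sigma> - \<tau>) = 1" using cs fs by (simp add: card_Diff_subset finite_subset)
    then obtain v where "\<sigma> - \<tau> = {v}" by (meson card_1_singletonE)
    then have "v \<in> \<sigma>" "\<tau> = \<sigma> - {v}" using t(1) by auto
    then show "\<tau> \<in> (\<lambda>v. \<sigma> - {v}) ` \<sigma>" by blast
  next
    fix \<tau> assume "\<tau> \<in> (\<lambda>v. \<sigma> - {v}) ` \<sigma>"
    then obtain v where v: "v \<in> \<sigma>" "\<tau> = \<sigma> - {v}" by blast
    then have "card \<sigma> = Suc (card \<tau>)" using card_Suc_Diff1[OF fs v(1)] by simp
    then show "\<tau> \<in> {\<tau>. \<tau> \<in> faces_of_dim K (k - 1) \<and> \<tau> \<subseteq> \<sigma>}"
      using sub[of \<tau>] v cs by (auto simp: faces_of_dim_def face_dim_def)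
  qed
  moreover have "inj_on (\<lambda>v. \<sigma> - {v}) \<sigma>" by (auto simp: inj_on_def)
  ultimately have "(\<Sum>\<tau> | \<tau> \<in> faces_of_dim K (k - 1) \<and> \<tau> \<subseteq> \<sigma>. of_bool (P \<tau>) :: bit) =
      (\<Sum>v\<in>\<sigma>. of_bool (P (\<sigma> - {v})))"
    by (simp add: sum.reindex)
  also have "\<dots> = of_nat (card {v \<in> \<sigma>. P (\<sigma> - {v})})"
    using fs by (simp add: Int_def)
  also have "\<dots> = of_bool (odd (card {v \<in> \<sigma>. P (\<sigma> - {v})}))"
    by (rule of_nat_bit_eq_odd)
  finally show ?thesis .
qed

lemma spanning_tree_Caratheodory:
  fixes a :: "'v::finite \<Rightarrow> 'e::euclidean_space"
  assumes M: "matroidal V M" and r: "rank_fun M V = int (dim W) + 1"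
    and dimM: "\<And>\<sigma>. \<sigma> \<in> M \<Longrightarrow> card \<sigma> \<le> Suc (dim W)"
    and T: "Z2_spanning_tree (dim W) M T"
    and W: "subspace W" "a ` V \<subseteq> W"
    and co: "\<And>S. cocircuit V M S \<Longrightarrow> pos_comb a S 0"
  shows "\<exists>\<sigma>\<in>T. \<sigma> \<noteq> {} \<and> pos_comb a \<sigma> 0"
proof (rule ccontr)
  assume none: "\<not> ?thesis"
  let ?d = "dim W"
  have scM: "simplicial_complex_on V M" using M by (simp add: matroidal_def)
  obtain s where s: "s \<in> M" "s \<noteq> {}" "pos_comb a s 0"
    using matroidal_Caratheodory[OF M r W co] by blast
  then have sT: "s \<notin> T" using none by blast
  have TM: "T \<subseteq> M" and skel: "\<And>\<sigma>. \<sigma> \<in> M \<Longrightarrow> card \<sigma> \<le> ?d \<Longrightarrow> \<sigma> \<in> T"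
    using T by (auto simp: Z2_spanning_tree_def face_dim_def)
  define K where "K = insert s T"
  obtain z where z: "z \<in> cycles (int ?d) K" "z s = 1"
    using spanning_tree_cycle[OF scM _ dimM T s(1) sT] by (auto simp: K_def)
  have KM: "K \<subseteq> M" using TM s(1) by (simp add: K_def)
  have proper: "\<tau> \<in> T" if "\<sigma> \<in> K" "\<tau> \<subset> \<sigma>" for \<sigma> \<tau>
  proof -
    have "\<sigma> \<in> M" using that KM by blast
    then have "\<tau> \<in> M" using scM that by (auto simp: simplicial_complex_on_def)
    moreover have "card \<tau> < card \<sigma>" using that by (simp add: psubset_card_mono)
    ultimately show ?thesis using skel dimM[OF \<open>\<sigma> \<in> M\<close>] by simp
  qed
  have scK: "simplicial_complex_on V K"
    unfolding simplicial_complex_on_def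
  proof (intro conjI ballI allI impI)
    show "{} \<in> K" using T by (auto simp: Z2_spanning_tree_def simplicial_complex_on_def K_def)
    show "finite \<sigma>" "\<sigma> \<subseteq> V" if "\<sigma> \<in> K" for \<sigma>
      using that KM scM by (auto simp: simplicial_complex_on_def)
    show "\<tau> \<in> K" if "\<sigma> \<in> K" "\<tau> \<subseteq> \<sigma>" for \<sigma> \<tau>
      using that proper[of \<sigma> \<tau>] by (cases "\<tau> = \<sigma>") (auto simp: K_def)
  qed
  obtain w where w: "w \<in> W" "\<And>\<tau>. card \<tau> < ?d \<Longrightarrow> w \<notin> span (a ` \<tau>)"
    using generic_point[OF W(1)] by metis
  \<comment> \<open>Proper faces of members of \<open>K\<close> lie in \<open>T\<close>, hence avoid
    0, so the parity count detects which \<open>d\<close>-faces of \<open>K\<close> cover 0; only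
    \<open>s\<close> does.\<close>
  have par: "odd (card {v \<in> \<sigma>. pos_comb a (\<sigma> - {v}) w}) \<longleftrightarrow> \<sigma> = s"
    if \<sigma>: "\<sigma> \<in> faces_of_dim K (int ?d)" for \<sigma>
  proof -
    have \<sigma>K: "\<sigma> \<in> K" "card \<sigma> = Suc ?d" using \<sigma> by (auto simp: faces_of_dim_def face_dim_def)
    have "a ` \<sigma> \<subseteq> W" using \<sigma>K(1) scK W(2) by (auto simp: simplicial_complex_on_def)
    moreover have "\<not> pos_comb a \<tau> 0" if "\<tau> \<subset> \<sigma>" "\<tau> \<noteq> {}" for \<tau>
      using none proper[OF \<sigma>K(1) that(1)] that(2) by blast
    ultimately have "odd (card {v \<in> \<sigma>. pos_comb a (\<sigma> - {v}) w}) \<longleftrightarrow> pos_comb a \<sigma> 0"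
      using pos_comb_parity_generic[OF finite \<sigma>K(2) W(1) _ w] by blast
    also have "\<dots> \<longleftrightarrow> \<sigma> = s"
      using none s(3) \<sigma>K by (auto simp: K_def)
    finally show ?thesis .
  qed
  \<comment> \<open>The chain \<open>z\<close> vanishes off the \<open>d\<close>-faces, but
    \<open>z s = 1\<close>.\<close>
  have "s \<in> faces_of_dim K (int ?d)"
    using z by (force simp: cycles_def chains_def)
  moreover have "finite (faces_of_dim K (int ?d))" by simp
  ultimately have "1 = (\<Sum>\<sigma>\<in>faces_of_dim K (int ?d). if \<sigma> = s then z \<sigma> else 0)"
    using z(2) by simp
  \<comment> \<open>By \<open>par\<close>, the indicator of \<open>s\<close> is the coboundary of
    the cochain marking the faces whose open cone contains \<open>w\<close>.\<close>
  also have "\<dots> = (\<Sum>\<sigma>\<in>faces_of_dim K (int ?d). z \<sigma> *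
      (\<Sum>\<tau> | \<tau> \<in> faces_of_dim K (int ?d - 1) \<and> \<tau> \<subseteq> \<sigma>. of_bool (pos_comb a \<tau> w)))"
    using par by (intro sum.cong refl, subst facet_sum_eq_card[OF scK]) auto
  also have "\<dots> = 0" by (intro sum_over_cycle_eq_0[OF _ z(1)]) simp
  finally show False by simp
qed

section \<open>From affine maps to positive combinations\<close>

text \<open>The basis vectors are affinely independent, so the relative interior is given by
  positive barycentric coordinates; injectivity of \<open>axis\<close> lets these be indexed by
  vertices instead of points.\<close>

lemma open_simplex_explicit:
  "open_simplex \<sigma> =
    {\<Sum>v\<in>\<sigma>. u v *\<^sub>R axis v 1 | u. (\<forall>v\<in>\<sigma>. 0 < u v) \<and> sum u \<sigma> = 1}"
proof -
  let ?e = "\<lambda>v. axis v (1::real)"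
  have inj: "inj_on ?e \<sigma>" by (auto simp: inj_on_def axis_eq_axis)
  have "independent (?e ` \<sigma>)"
    by (rule independent_mono[OF independent_Basis]) auto
  then have "\<not> affine_dependent (?e ` \<sigma>)" using affine_dependent_imp_dependent by blast
  then have "open_simplex \<sigma> = {y. \<exists>u. (\<forall>v\<in>\<sigma>. 0 < u (?e v)) \<and> (\<Sum>v\<in>\<sigma>. u (?e v)) = 1 \<and>
      (\<Sum>v\<in>\<sigma>. u (?e v) *\<^sub>R ?e v) = y}"
    by (simp add: open_simplex_def rel_interior_convex_hull_explicit sum.reindex[OF inj])
  also have "\<dots> = {\<Sum>v\<in>\<sigma>. u v *\<^sub>R ?e v | u. (\<forall>v\<in>\<sigma>. 0 < u v) \<and> sum u \<sigma> = 1}" (is "?L = ?R")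
  proof (intro equalityI subsetI)
    fix y assume "y \<in> ?L"
    then obtain u where "\<forall>v\<in>\<sigma>. 0 < u (?e v)" "(\<Sum>v\<in>\<sigma>. u (?e v)) = 1"
      "(\<Sum>v\<in>\<sigma>. u (?e v) *\<^sub>R ?e v) = y" by blast
    then show "y \<in> ?R" by (intro CollectI exI[of _ "\<lambda>v. u (?e v)"]) auto
  next
    fix y assume "y \<in> ?R"
    then obtain u where u: "\<forall>v\<in>\<sigma>. 0 < u v" "sum u \<sigma> = 1" "y = (\<Sum>v\<in>\<sigma>. u v *\<^sub>R ?e v)" by blast
    have "inv_into \<sigma> ?e (?e v) = v" if "v \<in> \<sigma>" for v
      using inv_into_f_f[OF inj that] .
    then show "y \<in> ?L"
      using u by (intro CollectI exI[of _ "\<lambda>x. u (inv_into \<sigma> ?e x)"]) auto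
  qed
  finally show ?thesis .
qed

lemma zero_in_affine_image_iff:
  assumes A: "affine_map (Pow V) d A" and \<sigma>: "\<sigma> \<subseteq> V"
  shows "(\<lambda>i. 0) \<in> A ` open_simplex \<sigma> \<longleftrightarrow>
    \<sigma> \<noteq> {} \<and> (\<exists>u. (\<forall>v\<in>\<sigma>. 0 < u v) \<and> (\<forall>i. (\<Sum>v\<in>\<sigma>. u v * A (axis v 1) i) = 0))"
proof -
  have aff: "A (\<Sum>v\<in>\<sigma>. u v *\<^sub>R axis v 1) = (\<lambda>i. \<Sum>v\<in>\<sigma>. u v * A (axis v 1) i)"
    if "\<forall>v\<in>\<sigma>. 0 < u v" "sum u \<sigma> = 1" for u
    using A \<sigma> that by (auto simp: affine_map_def less_imp_le)
  show ?thesis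
  proof (intro iffI conjI)
    assume "(\<lambda>i. 0) \<in> A ` open_simplex \<sigma>"
    then obtain u where u: "\<forall>v\<in>\<sigma>. 0 < u v" "sum u \<sigma> = 1"
      "(\<lambda>i. 0) = A (\<Sum>v\<in>\<sigma>. u v *\<^sub>R axis v 1)" by (auto simp: open_simplex_explicit)
    then show "\<sigma> \<noteq> {}" by auto
    have "(\<Sum>v\<in>\<sigma>. u v * A (axis v 1) i) = 0" for i
      using u(3) unfolding aff[OF u(1,2)] by metis
    then show "\<exists>u. (\<forall>v\<in>\<sigma>. 0 < u v) \<and> (\<forall>i. (\<Sum>v\<in>\<sigma>. u v * A (axis v 1) i) = 0)"
      using u(1) by blast
  next
    assume "\<sigma> \<noteq> {} \<and> (\<exists>u. (\<forall>v\<in>\<sigma>. 0 < u v) \<and> (\<forall>i. (\<Sum>v\<in>\<sigma>. u v * A (axis v 1) i) = 0))"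
    then obtain u where ne: "\<sigma> \<noteq> {}" and u: "\<And>v. v \<in> \<sigma> \<Longrightarrow> 0 < u v"
      "\<And>i. (\<Sum>v\<in>\<sigma>. u v * A (axis v 1) i) = 0" by blast
    define q where "q v = u v / sum u \<sigma>" for v
    have pos: "0 < sum u \<sigma>" using ne u(1) by (intro sum_pos) auto
    have q: "\<forall>v\<in>\<sigma>. 0 < q v" "sum q \<sigma> = 1"
      using pos u(1) by (auto simp: q_def sum_divide_distrib[symmetric])
    have "(\<Sum>v\<in>\<sigma>. q v * A (axis v 1) i) = 0" for i
      using u(2)[of i] by (simp add: q_def sum_divide_distrib[symmetric])
    then have "(\<lambda>i. 0) = A (\<Sum>v\<in>\<sigma>. q v *\<^sub>R axis v 1)" by (simp add: aff[OF q])
    then show "(\<lambda>i. 0) \<in> A ` open_simplex \<sigma>" using q by (auto simp: open_simplex_explicit)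
  qed
qed

lemma affine_map_axis:
  assumes "affine_map (Pow V) d A" "v \<in> V" "d \<le> i"
  shows "A (axis v 1) i = 0"
proof -
  have "axis v 1 \<in> open_simplex {v}"
    unfolding open_simplex_explicit by (intro CollectI exI[of _ "\<lambda>_. 1"]) simp
  then have "axis v 1 \<in> realization (Pow V)" using assms(2) by (auto simp: realization_def)
  then show ?thesis using assms by (auto simp: affine_map_def topspace_Euclidean_space)
qed

theorem theorem14:
  fixes d :: nat and V :: "'v::finite set" and M T :: "'v set set"
    and A :: "real ^ 'v \<Rightarrow> nat \<Rightarrow> real"
  assumes "matroidal V M"
    and "rank_fun M V = int d + 1"
    and "Z2_spanning_tree d M T"
    and "affine_map (Pow V) d A"
    and "\<And>S. cocircuit V M S \<Longrightarrow> (\<lambda>i. 0) \<in> A ` open_simplex S"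
  shows "\<exists>\<sigma>\<in>T. (\<lambda>i. 0) \<in> A ` open_simplex \<sigma>"
proof -
  have MV: "\<And>\<sigma>. \<sigma> \<in> M \<Longrightarrow> \<sigma> \<subseteq> V"
    using assms(1) by (auto simp: matroidal_def simplicial_complex_on_def)
  then have "induced_complex M V = M" by (auto simp: induced_complex_def)
  then have dimM: "Max (face_dim ` M) = int d"
    using assms(2) by (simp add: rank_fun_def complex_dim_def)
  have cM: "card \<sigma> \<le> Suc d" if "\<sigma> \<in> M" for \<sigma>
    using that dimM Max_ge[of "face_dim ` M" "face_dim \<sigma>"] by (simp add: face_dim_def)
  have "M \<noteq> {}" using assms(1) by (auto simp: matroidal_def simplicial_complex_on_def)
  then have "int d \<in> face_dim ` M" using dimM Max_in[of "face_dim ` M"] by simp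
  \<comment> \<open>A face with \<open>d + 1\<close> elements shows that the index type has room for
    \<open>d\<close> distinct coordinates.\<close>
  then obtain B where "B \<in> M" "int d = face_dim B" by blast
  then have "card {..<d} \<le> card (UNIV :: 'v set)"
    using card_mono[of "UNIV :: 'v set" B] by (simp add: face_dim_def)
  then obtain f :: "nat \<Rightarrow> 'v" where f: "inj_on f {..<d}"
    using card_le_inj[of "{..<d}" "UNIV :: 'v set"] by auto
  let ?e = "\<lambda>i. axis (f i) 1 :: real ^ 'v"
  \<comment> \<open>A \<open>d\<close>-dimensional coordinate subspace of \<open>real ^ 'v\<close>
    serves as the target. Being a subspace and not a type, it may have dimension 0.\<close>
  define W where "W = span (?e ` {..<d})"
  define a where "a v = (\<Sum>i<d. A (axis v 1) i *\<^sub>R ?e i)" for v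
  have "independent (?e ` {..<d})"
    by (rule independent_mono[OF independent_Basis]) auto
  moreover have "inj_on ?e {..<d}" using f by (auto simp: inj_on_def axis_eq_axis)
  ultimately have dW: "dim W = d"
    unfolding W_def by (simp add: dim_eq_card_independent card_image)
  have "a v \<in> W" for v
    unfolding a_def W_def by (intro span_sum, rule span_scale, rule span_base) simp
  then have aW: "a ` V \<subseteq> W" by blast
  have e0: "(\<Sum>i<d. c i *\<^sub>R ?e i) = 0 \<longleftrightarrow> (\<forall>i<d. c i = 0)" for c
  proof
    assume 0: "(\<Sum>i<d. c i *\<^sub>R ?e i) = 0"
    have "c k = 0" if "k < d" for k
    proof -
      have "0 = (\<Sum>i<d. c i *\<^sub>R ?e i) $ f k" using 0 by simp
      also have "\<dots> = (\<Sum>i<d. if i = k then c i else 0)"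
        unfolding sum_component using f that
        by (intro sum.cong refl) (auto simp: axis_def inj_on_eq_iff)
      finally show ?thesis using that by simp
    qed
    then show "\<forall>i<d. c i = 0" by blast
  qed simp
  \<comment> \<open>The map \<open>a\<close> records only the first \<open>d\<close> coordinates;
    the others vanish at all vertices in \<open>V\<close>, so nothing is lost.\<close>
  have bridge: "(\<lambda>i. 0) \<in> A ` open_simplex \<sigma> \<longleftrightarrow> \<sigma> \<noteq> {} \<and> pos_comb a \<sigma> 0" if \<sigma>: "\<sigma> \<subseteq> V" for \<sigma>
  proof -
    let ?c = "\<lambda>u i. \<Sum>v\<in>\<sigma>. u v * A (axis v 1) i"
    have comb: "(\<Sum>v\<in>\<sigma>. u v *\<^sub>R a v) = (\<Sum>i<d. ?c u i *\<^sub>R ?e i)" for u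
      unfolding a_def scaleR_sum_right scaleR_sum_left by (subst sum.swap) simp
    have "?c u i = 0" if "d \<le> i" for u i
      using affine_map_axis[OF assms(4) _ that] \<sigma> by (intro sum.neutral) auto
    then have "(\<forall>i<d. ?c u i = 0) \<longleftrightarrow> (\<forall>i. ?c u i = 0)" for u
      using not_le by blast
    then have "(\<Sum>v\<in>\<sigma>. u v *\<^sub>R a v) = 0 \<longleftrightarrow> (\<forall>i. ?c u i = 0)" for u
      unfolding comb e0 .
    then show ?thesis unfolding zero_in_affine_image_iff[OF assms(4) \<sigma>] pos_comb_def by simp
  qed
  have "pos_comb a S 0" if "cocircuit V M S" for S
    using assms(5)[OF that] bridge[of S] that by (auto simp: cocircuit_def)
  then obtain \<sigma> where "\<sigma> \<in> T" "\<sigma> \<noteq> {}" "pos_comb a \<sigma> 0"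
    using spanning_tree_Caratheodory[of V M W T a] assms(1,2,3) dW cM aW
    by (auto simp: W_def)
  moreover have "\<sigma> \<subseteq> V" using \<open>\<sigma> \<in> T\<close> assms(3) MV by (auto simp: Z2_spanning_tree_def)
  ultimately show ?thesis using bridge by blast
qed

end
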